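(* Let $(b_n)_{n\ge 0}$ be the Catalan transform of the Catalan numbers $(C_n)_{n\ge 0}$, that is, $$b_n=\sum_{k=0}^{n}\frac{k}{2n-k}\binom{2n-k}{n-k}C_k ,$$ where the coefficient $\frac{k}{2n-k}\binom{2n-k}{n-k}$ is interpreted as $1$ when $n=k=0$, and $C_k=\frac{1}{k+1}\binom{2k}{k}$. Then for every nonnegative integer $n$, $b_n$ equals the number of functions $f:[1,n]\to[1,n]$ such that for all $1\le i<j\le n$, the integer $f(j)-(j-i)$ does not lie in the interval $[1,f(i)-1]$.
   Context: $[a,b]$ denotes the set of integers $m$ with $a\le m\le b$ (empty if $b<a$). The Catalan transform of a sequence $(a_n)_{n\ge0}$ is the sequence $(b_n)_{n\ge 0}$ with $b_n=\sum_{k=0}^{n}\frac{k}{2n-k}\binom{2n-k}{n-k}a_k$, the coefficient being $1$ when $n=k=0$. *)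

theory Defs
  imports Complex_Main "HOL-Library.FuncSet"
begin

definition catalan :: "nat \<Rightarrow> rat" where
  "catalan k = 1 / (of_nat k + 1) * of_nat ((2 * k) choose k)"

(* Only used for k \<le> n, where the subtractions on nat do not truncate.
   The case n = k = 0 is a convention: the formula would give 0 / 0 = 0. *)
definition catalan_coeff :: "nat \<Rightarrow> nat \<Rightarrow> rat" where
  "catalan_coeff n k =
     (if n = 0 \<and> k = 0 then 1
      else of_nat k / of_nat (2 * n - k) * of_nat ((2 * n - k) choose (n - k)))"

definition catalan_transform :: "(nat \<Rightarrow> rat) \<Rightarrow> nat \<Rightarrow> rat" where
  "catalan_transform a n = (\<Sum>k=0..n. catalan_coeff n k * a k)"

(* Extensional functions, so that each map from [1,n] to [1,n] is counted once. *)
definition avoiding_functions :: "nat \<Rightarrow> (int \<Rightarrow> int) set" where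
  "avoiding_functions n =
     {f \<in> {1..int n} \<rightarrow>\<^sub>E {1..int n}.
        \<forall>i j. 1 \<le> i \<and> i < j \<and> j \<le> int n \<longrightarrow> f j - (j - i) \<notin> {1..f i - 1}}"

end

theory Submission
  imports Defs
begin

text \<open>
  Put \<open>h i = i - f i\<close>. The condition says that \<open>h k\<close> never lies strictly between \<open>h i\<close> and \<open>i\<close> for
  \<open>i < k\<close>, so the admissible values of \<open>h\<close> behave like a stack: choosing \<open>h j = a\<close> removes all
  admissible values above \<open>a\<close> and pushes \<open>j\<close>, while \<open>f j \<le> n\<close> lets one nonpositive value expire from
  the bottom at each step. Hence the number of completions depends only on the number \<open>r\<close> of remaining
  steps and on the numbers \<open>m\<close> and \<open>s\<close> of nonpositive and positive admissible values. If \<open>C(z)\<close> is the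
  Catalan series and \<open>B p j\<close> is the coefficient of \<open>z^j\<close> in \<open>C(z)^p\<close>, the solution of the resulting
  recursion for \<open>m \<le> r\<close> is
  \<open>B s r + (\<Sum>j\<le>m. B 1 (r - j) * (B (m - j + s) j - B (s - 1) j))\<close>,
  which was found with a generating function in two variables. At \<open>m = r = n\<close>, \<open>s = 0\<close> it is the
  Catalan transform.
\<close>

section \<open>Powers of the Catalan series and the coefficients of the transform\<close>

text \<open>This is \<open>B p j\<close>; the recursion reads
  \<open>C^(p+1) = C^p + z C^(p+2)\<close>, which is \<open>C = 1 + z C^2\<close> times
  \<open>C^p\<close>.\<close>

fun ballot :: "nat \<Rightarrow> nat \<Rightarrow> nat" where
  "ballot p 0 = 1"
| "ballot 0 (Suc j) = 0"
| "ballot (Suc p) (Suc j) = ballot p (Suc j) + ballot (Suc (Suc p)) j"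

lemma ballot_0: "ballot 0 j = (if j = 0 then 1 else 0)"
  by (cases j) auto

text \<open>Both terms of the recursion share \<open>N = 2 * j + p + 2\<close> and give adjacent
  binomials \<open>x\<close>, \<open>y\<close> of known ratio. The form without division also covers
  \<open>p = j = 0\<close>.\<close>

lemma ballot_closed_form: "(2 * j + p) * ballot p j = p * ((2 * j + p) choose j)"
proof (induction p j rule: ballot.induct)
  case (3 p j)
  define N where "N = 2 * j + p + 2"
  define x where "x = N choose j"
  define y where "y = N choose Suc j"
  have IH1: "N * ballot p (Suc j) = p * y"
    using "3.IH"(1) by (simp add: N_def y_def)
  have IH2: "N * ballot (Suc (Suc p)) j = (p + 2) * x"
    using "3.IH"(2) by (simp add: N_def x_def)
  have "Suc j * y = (N - j) * x"
    unfolding x_def y_def by (metis binomial_absorb_comp binomial_absorption)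
  hence xy: "Suc j * y = (j + p + 2) * x"
    by (simp add: N_def)
  have "N * (Suc N * ballot (Suc p) (Suc j)) = Suc N * (N * ballot p (Suc j) + N * ballot (Suc (Suc p)) j)"
    by (simp add: algebra_simps)
  also have "\<dots> = Suc N * (p * y + (p + 2) * x)"
    unfolding IH1 IH2 ..
  also have "\<dots> = N * (Suc p * (x + y))"
  proof -
    have "int (Suc j) * int y = int (j + p + 2) * int x"
      using xy by (metis of_nat_mult)
    hence "int (Suc N * (p * y + (p + 2) * x)) = int (N * (Suc p * (x + y)))"
      unfolding N_def of_nat_mult of_nat_add of_nat_Suc by simp algebra
    thus ?thesis by (simp only: of_nat_eq_iff)
  qed
  finally have "Suc N * ballot (Suc p) (Suc j) = Suc p * (x + y)"
    by (metis N_def add_is_0 mult_left_cancel zero_neq_numeral)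
  moreover have "Suc N choose Suc j = x + y"
    by (simp add: x_def y_def)
  ultimately show ?case
    by (simp add: N_def del: ballot.simps binomial_Suc_Suc)
qed auto

text \<open>The identity \<open>C^(p+1) = C^p C\<close>: both sides obey the recursion of
  \<open>ballot\<close>.\<close>

lemma ballot_convolution: "ballot (Suc p) n = (\<Sum>j\<le>n. ballot p j * ballot 1 (n - j))"
proof (induction p n rule: ballot.induct)
  case (2 j)
  show ?case by (simp add: sum.atMost_Suc_shift del: sum.atMost_Suc)
next
  case (3 p n)
  have "ballot (Suc (Suc p)) (Suc n) = ballot (Suc p) (Suc n) + ballot (Suc (Suc (Suc p))) n"
    by simp
  also have "\<dots> = (\<Sum>j\<le>Suc n. ballot p j * ballot 1 (Suc n - j))
      + (\<Sum>j\<le>n. ballot (Suc (Suc p)) j * ballot 1 (n - j))"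
    unfolding "3.IH" ..
  also have "\<dots> = (\<Sum>j\<le>Suc n. ballot (Suc p) j * ballot 1 (Suc n - j))"
    unfolding sum.atMost_Suc_shift by (simp add: algebra_simps sum.distrib)
  finally show ?case .
qed simp

lemma catalan_eq_ballot: "catalan k = of_nat (ballot 1 k)"
proof -
  have "Suc k * (Suc (2 * k) choose k) = Suc (2 * k) * (2 * k choose k)"
    using binomial_absorb_comp[of "Suc (2 * k)" k] by (simp add: Suc_diff_le)
  moreover have "Suc (2 * k) * ballot 1 k = (Suc (2 * k) choose k)"
    using ballot_closed_form[of k 1] by simp
  ultimately have "Suc (2 * k) * (Suc k * ballot 1 k) = Suc (2 * k) * (2 * k choose k)"
    by (metis mult.left_commute)
  hence "Suc k * ballot 1 k = (2 * k choose k)"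
    by (simp del: mult_Suc)
  hence "(of_nat k + 1) * (of_nat (ballot 1 k) :: rat) = of_nat (2 * k choose k)"
    by (metis of_nat_Suc of_nat_mult add.commute)
  moreover have "(of_nat k + 1 :: rat) \<noteq> 0"
    by (metis of_nat_Suc of_nat_neq_0 add.commute)
  ultimately show ?thesis
    by (simp add: catalan_def field_simps)
qed

lemma catalan_coeff_eq_ballot:
  assumes "k \<le> n"
  shows "catalan_coeff n k = of_nat (ballot k (n - k))"
proof (cases "n = 0")
  case False
  have "2 * (n - k) + k = 2 * n - k"
    using assms by simp
  hence "(2 * n - k) * ballot k (n - k) = k * ((2 * n - k) choose (n - k))"
    using ballot_closed_form[of "n - k" k] by simp
  hence "of_nat (2 * n - k) * (of_nat (ballot k (n - k)) :: rat)
      = of_nat k * of_nat ((2 * n - k) choose (n - k))"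
    by (metis of_nat_mult)
  moreover have "(of_nat (2 * n - k) :: rat) \<noteq> 0"
    using assms False by simp
  ultimately show ?thesis
    using False unfolding catalan_coeff_def by (metis nonzero_mult_div_cancel_left times_divide_eq_left)
qed (use assms in \<open>simp add: catalan_coeff_def\<close>)

text \<open>The coefficient of \<open>z^j\<close> in \<open>C(z)^(s-1)\<close>, where \<open>s = 0\<close> is allowed: \<open>1 / C(z) = 1 - z C(z)\<close>.\<close>

definition ballot_pred :: "nat \<Rightarrow> nat \<Rightarrow> int" where
  "ballot_pred s j = int (ballot s j) - (case j of 0 \<Rightarrow> 0 | Suc i \<Rightarrow> int (ballot (Suc s) i))"

lemma ballot_pred_0 [simp]: "ballot_pred s 0 = 1"
  by (simp add: ballot_pred_def)

lemma ballot_pred_Suc [simp]: "ballot_pred (Suc s) j = int (ballot s j)"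
  by (cases j) (simp_all add: ballot_pred_def)

lemma ballot_pred_0_Suc: "ballot_pred 0 (Suc j) = - int (ballot 1 j)"
  by (simp add: ballot_pred_def)

text \<open>The relation \<open>C^s - C^(s-1) = z C^(s+1)\<close>, including
  \<open>s = 0\<close>.\<close>

lemma ballot_pred_diff:
  "ballot_pred (Suc s) (Suc j) - ballot_pred s (Suc j) = int (ballot (Suc s) j)"
  by (simp add: ballot_pred_def)

section \<open>The stack recursion and its solution\<close>

text \<open>Taking the positive value with \<open>t\<close> positive ones below it keeps
  \<open>t + 1\<close> and pushes one, while the lowest nonpositive value expires. Taking a
  nonpositive value with \<open>k\<close> below it removes all positive ones, and expiry leaves
  \<open>k\<close>.\<close>

fun stack_walks :: "nat \<Rightarrow> nat \<Rightarrow> nat \<Rightarrow> nat" where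
  "stack_walks 0 m s = 1"
| "stack_walks (Suc r) m s =
     (\<Sum>t<s. stack_walks r (m - 1) (Suc (Suc t))) + (\<Sum>k<m. stack_walks r k 1)"

definition walk_formula :: "nat \<Rightarrow> nat \<Rightarrow> nat \<Rightarrow> int" where
  "walk_formula r m s = int (ballot s r) +
     (\<Sum>j\<le>m. int (ballot 1 (r - j)) * (int (ballot (m - j + s) j) - ballot_pred s j))"

lemma walk_formula_0 [simp]: "walk_formula r 0 s = int (ballot s r)"
  by (simp add: walk_formula_def)

text \<open>The recursion differenced in \<open>s\<close>: \<open>C^(p+1) - C^p = z C^(p+2)\<close>
  applies in every summand, and the factor \<open>z\<close> shifts \<open>j\<close> by one.\<close>

lemma walk_formula_diff_s:
  "walk_formula (Suc r) m (Suc s) - walk_formula (Suc r) m s = walk_formula r (m - 1) (Suc (Suc s))"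
proof (cases m)
  case (Suc m')
  have "walk_formula (Suc r) m (Suc s) - walk_formula (Suc r) m s = int (ballot (Suc (Suc s)) r) +
     (\<Sum>j\<le>Suc m'. int (ballot 1 (Suc r - j)) *
        ((int (ballot (Suc (Suc m' - j + s)) j) - int (ballot (Suc m' - j + s) j))
         - (ballot_pred (Suc s) j - ballot_pred s j)))"
    unfolding walk_formula_def Suc
    by (simp add: algebra_simps sum_subtractf sum.distrib del: sum.atMost_Suc ballot_pred_Suc)
  also have "\<dots> = walk_formula r m' (Suc (Suc s))"
    unfolding sum.atMost_Suc_shift walk_formula_def
    by (simp add: ballot_pred_diff del: ballot_pred_Suc)
       (simp add: algebra_simps)
  finally show ?thesis
    using Suc by simp
qed simp

text \<open>The recursion differenced in \<open>m\<close> at \<open>s = 0\<close>. The new summand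
  \<open>j = m + 1\<close> reduces to its \<open>ballot_pred\<close> part and becomes the top term
  of the shifted sum.\<close>

lemma walk_formula_diff_m:
  assumes "m \<le> r"
  shows "walk_formula (Suc r) (Suc m) 0 - walk_formula (Suc r) m 0 = walk_formula r m 1"
proof -
  have split: "int (ballot (Suc m - j) j) - int (ballot (m - j) j)
      = (case j of 0 \<Rightarrow> 0 | Suc i \<Rightarrow> int (ballot (Suc (m - i)) i))" if "j \<le> m" for j
  proof (cases j)
    case (Suc i)
    define d where "d = m - Suc i"
    have "m = d + Suc i"
      using that Suc by (simp add: d_def)
    thus ?thesis by (simp add: Suc Suc_diff_le)
  qed simp
  have "walk_formula (Suc r) (Suc m) 0 - walk_formula (Suc r) m 0 =
     (\<Sum>j\<le>m. int (ballot 1 (Suc r - j)) * (int (ballot (Suc m - j) j) - int (ballot (m - j) j)))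
     + int (ballot 1 (r - m)) * int (ballot 1 m)"
    unfolding walk_formula_def
    by (simp add: ballot_pred_0_Suc algebra_simps sum_subtractf sum.distrib)
  also have "(\<Sum>j\<le>m. int (ballot 1 (Suc r - j)) * (int (ballot (Suc m - j) j) - int (ballot (m - j) j)))
     = (\<Sum>j\<le>m. int (ballot 1 (Suc r - j)) * (case j of 0 \<Rightarrow> 0 | Suc i \<Rightarrow> int (ballot (Suc (m - i)) i)))"
    using split by (intro sum.cong) auto
  also have "\<dots> = (\<Sum>j<m. int (ballot 1 (r - j)) * int (ballot (Suc (m - j)) j))"
    unfolding lessThan_Suc_atMost[symmetric] sum.lessThan_Suc_shift by simp
  also have "\<dots> + int (ballot 1 (r - m)) * int (ballot 1 m)
     = (\<Sum>j\<le>m. int (ballot 1 (r - j)) * int (ballot (Suc (m - j)) j))"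
    by (simp add: lessThan_Suc_atMost[symmetric])
  also have "\<dots> = walk_formula r m 1"
  proof -
    \<comment> \<open>At \<open>s = 1\<close> the \<open>ballot_pred\<close> part cancels the
      leading \<open>ballot 1 r\<close>.\<close>
    have "(\<Sum>j\<le>m. int (ballot 1 (r - j)) * int (ballot 0 j))
        = (\<Sum>j\<le>m. if j = 0 then int (ballot 1 r) else 0)"
      by (intro sum.cong) (auto simp: ballot_0)
    thus ?thesis
      by (simp add: walk_formula_def right_diff_distrib sum_subtractf)
  qed
  finally show ?thesis .
qed

text \<open>The two difference lemmas telescope the sums of the recursion, starting from
  \<open>walk_formula (Suc r) 0 0 = 0\<close>.\<close>

lemma stack_walks_eq_formula:
  "m \<le> r \<Longrightarrow> int (stack_walks r m s) = walk_formula r m s"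
proof (induction r arbitrary: m s)
  case (Suc r)
  note IH = Suc.IH
  have base: "(\<Sum>k<m. int (stack_walks r k 1)) = walk_formula (Suc r) m 0"
    using Suc.prems
  proof (induction m)
    case (Suc m)
    thus ?case
      using walk_formula_diff_m[of m r] IH[of m 1] by simp
  qed simp
  have "(\<Sum>t<s. int (stack_walks r (m - 1) (Suc (Suc t)))) + walk_formula (Suc r) m 0
      = walk_formula (Suc r) m s"
  proof (induction s)
    case (Suc s)
    thus ?case
      using walk_formula_diff_s[of r m s] \<open>m \<le> Suc r\<close> IH[of "m - 1" "Suc (Suc s)"] by simp
  qed simp
  thus ?case
    using base by simp
qed simp

lemma stack_walks_diagonal:
  "int (stack_walks n n 0) = (\<Sum>j\<le>n. int (ballot 1 (n - j)) * int (ballot (n - j) j))"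
proof -
  \<comment> \<open>This is \<open>C * (1 / C) = 1\<close>; it cancels the leading
    \<open>ballot 0 n\<close>.\<close>
  have "(\<Sum>j\<le>n. int (ballot 1 (n - j)) * ballot_pred 0 j) = int (ballot 0 n)"
  proof (cases n)
    case (Suc m)
    have "(\<Sum>j\<le>m. int (ballot 1 (m - j)) * int (ballot 1 j)) = int (ballot 2 m)"
      using ballot_convolution[of 1 m] by (simp add: mult.commute numeral_2_eq_2)
    thus ?thesis
      unfolding Suc sum.atMost_Suc_shift by (simp add: ballot_pred_0_Suc sum_negf numeral_2_eq_2)
  qed simp
  thus ?thesis
    by (simp add: stack_walks_eq_formula walk_formula_def right_diff_distrib sum_subtractf)
qed

section \<open>Counting functions through the stack of admissible values\<close>

text \<open>The ranks in \<open>P\<close> run through 1 to \<open>card P\<close>; inserting a new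
  maximum leaves the other ranks unchanged.\<close>

lemma sum_card_le:
  fixes P :: "'a::linorder set" and g :: "nat \<Rightarrow> nat"
  assumes "finite P"
  shows "(\<Sum>p\<in>P. g (card {x \<in> P. x \<le> p})) = (\<Sum>t<card P. g (Suc t))"
  using assms
proof (induction P rule: finite_linorder_max_induct)
  case (insert b A)
  have "b \<notin> A" using insert by auto
  have "{x \<in> insert b A. x \<le> b} = insert b A" using insert by auto
  moreover have "{x \<in> insert b A. x \<le> p} = {x \<in> A. x \<le> p}" if "p \<in> A" for p
    using insert that by auto
  ultimately show ?case
    using insert \<open>b \<notin> A\<close> by (simp cong: sum.cong)
qed simp

text \<open>
  Restrictions to \<open>{j..n}\<close> of the functions counted, where \<open>A\<close> is the set of values of
  \<open>i - f i\<close> below \<open>j\<close> still allowed by the choices made before \<open>j\<close>.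
\<close>

definition avoiding_from :: "int \<Rightarrow> int \<Rightarrow> int set \<Rightarrow> (int \<Rightarrow> int) set" where
  "avoiding_from n j A =
     {f \<in> {j..n} \<rightarrow>\<^sub>E {1..n}. (\<forall>i\<in>{j..n}. i - f i \<in> A \<union> {j..}) \<and>
        (\<forall>i k. j \<le> i \<and> i < k \<and> k \<le> n \<longrightarrow> f k - (k - i) \<notin> {1..f i - 1})}"

lemma finite_avoiding_from: "finite (avoiding_from n j A)"
  by (rule finite_subset[of _ "{j..n} \<rightarrow>\<^sub>E {1..n}"]) (auto simp: avoiding_from_def intro!: finite_PiE)

text \<open>For \<open>f j = b\<close> the condition on pairs \<open>(j, k)\<close> says that
  \<open>k - f k\<close> avoids the open interval from \<open>j - b\<close> to \<open>j\<close>, so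
  \<open>j\<close> and the old values up to \<open>j - b\<close> survive.\<close>

lemma avoiding_from_step:
  assumes "j \<le> n"
  shows "avoiding_from n j A =
    (\<Union>b\<in>{b \<in> {1..n}. j - b \<in> A}. (\<lambda>g. g(j := b)) `
       avoiding_from n (j + 1) (insert j {x \<in> A. x \<le> j - b}))" (is "_ = ?R")
proof
  show "avoiding_from n j A \<subseteq> ?R"
  proof
    fix f assume f: "f \<in> avoiding_from n j A"
    hence fE: "f \<in> {j..n} \<rightarrow>\<^sub>E {1..n}"
      and fA: "\<And>i. j \<le> i \<Longrightarrow> i \<le> n \<Longrightarrow> i - f i \<in> A \<or> j \<le> i - f i"
      and fC: "\<And>i k. j \<le> i \<Longrightarrow> i < k \<Longrightarrow> k \<le> n \<Longrightarrow> f k - (k - i) \<notin> {1..f i - 1}"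
      by (auto simp: avoiding_from_def)
    have fj: "1 \<le> f j" "f j \<le> n" using fE assms by (auto simp: PiE_iff)
    \<comment> \<open>Resetting to \<open>undefined\<close> at \<open>j\<close> restricts the
      extensional function to \<open>{j + 1..n}\<close>.\<close>
    have "f(j := undefined) \<in> avoiding_from n (j + 1) (insert j {x \<in> A. x \<le> j - f j})"
      unfolding avoiding_from_def mem_Collect_eq
    proof (intro conjI ballI allI impI)
      show "f(j := undefined) \<in> {j + 1..n} \<rightarrow>\<^sub>E {1..n}"
        using fE by (auto simp: PiE_iff extensional_def)
    next
      fix i assume "i \<in> {j + 1..n}"
      thus "i - (f(j := undefined)) i \<in> insert j {x \<in> A. x \<le> j - f j} \<union> {j + 1..}"
        using fA[of i] fC[of j i] by auto
    next
      fix i k assume "j + 1 \<le> i \<and> i < k \<and> k \<le> n"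
      thus "(f(j := undefined)) k - (k - i) \<notin> {1..(f(j := undefined)) i - 1}"
        using fC[of i k] by auto
    qed
    moreover have "f = (f(j := undefined))(j := f j)" by simp
    moreover have "f j \<in> {b \<in> {1..n}. j - b \<in> A}" using fA[of j] fj assms by auto
    ultimately show "f \<in> ?R" by blast
  qed
next
  show "?R \<subseteq> avoiding_from n j A"
  proof safe
    fix b g assume b: "b \<in> {1..n}" "j - b \<in> A"
      and g: "g \<in> avoiding_from n (j + 1) (insert j {x \<in> A. x \<le> j - b})"
    from g have gE: "g \<in> {j + 1..n} \<rightarrow>\<^sub>E {1..n}"
      and gA: "\<And>i. j < i \<Longrightarrow> i \<le> n \<Longrightarrow> (i - g i \<in> A \<and> i - g i \<le> j - b) \<or> j \<le> i - g i"
      and gC: "\<And>i k. j < i \<Longrightarrow> i < k \<Longrightarrow> k \<le> n \<Longrightarrow> g k - (k - i) \<notin> {1..g i - 1}"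
      by (auto simp: avoiding_from_def)
    show "g(j := b) \<in> avoiding_from n j A"
      unfolding avoiding_from_def mem_Collect_eq
    proof (intro conjI ballI allI impI)
      show "g(j := b) \<in> {j..n} \<rightarrow>\<^sub>E {1..n}"
        using gE b assms by (auto simp: PiE_iff extensional_def)
    next
      fix i assume "i \<in> {j..n}"
      thus "i - (g(j := b)) i \<in> A \<union> {j..}"
        using gA[of i] b by (cases "i = j") auto
    next
      fix i k assume ik: "j \<le> i \<and> i < k \<and> k \<le> n"
      show "(g(j := b)) k - (k - i) \<notin> {1..(g(j := b)) i - 1}"
      proof (cases "i = j")
        case True
        thus ?thesis using gA[of k] ik by auto
      next
        case False
        thus ?thesis using gC[of i k] ik by auto
      qed
    qed
  qed
qed

lemma card_avoiding_from_step:
  assumes "j \<le> n"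
  shows "card (avoiding_from n j A) =
    (\<Sum>b\<in>{b \<in> {1..n}. j - b \<in> A}.
       card (avoiding_from n (j + 1) (insert j {x \<in> A. x \<le> j - b})))"
proof -
  have "inj_on (\<lambda>g. g(j := b)) (avoiding_from n (j + 1) B)" for b B
  proof (rule inj_onI)
    fix g h assume "g \<in> avoiding_from n (j + 1) B" "h \<in> avoiding_from n (j + 1) B"
      and eq: "g(j := b) = h(j := b)"
    hence "g j = h j" by (auto simp: avoiding_from_def PiE_iff extensional_def)
    thus "g = h" using eq by (metis fun_upd_triv fun_upd_upd)
  qed
  hence "card ((\<lambda>g. g(j := b)) ` avoiding_from n (j + 1) B) = card (avoiding_from n (j + 1) B)" for b B
    by (rule card_image)
  moreover have "finite {b \<in> {1..n}. j - b \<in> A}"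
    by (rule finite_subset[of _ "{1..n}"]) auto
  ultimately show ?thesis
    unfolding avoiding_from_step[OF assms]
    by (subst card_UN_disjoint) (auto simp: finite_avoiding_from dest: fun_cong[of _ _ j])
qed

text \<open>Expiry comes from \<open>f j \<le> n\<close>: it forces
  \<open>j - f j \<ge> 1 - int r\<close>, so \<open>nat (a + int r)\<close> values of the ray
  \<open>{..a}\<close> are usable.\<close>

lemma card_avoiding_from:
  assumes "a \<le> 0" "P \<subseteq> {1..<j}" "int r = n + 1 - j" "1 \<le> j"
  shows "card (avoiding_from n j ({..a} \<union> P)) = stack_walks r (nat (a + int r)) (card P)"
  using assms
proof (induction r arbitrary: a P j)
  case 0
  hence "avoiding_from n j ({..a} \<union> P) = {\<lambda>_. undefined}"
    by (auto simp: avoiding_from_def PiE_iff extensional_def)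
  thus ?case by simp
next
  case (Suc r)
  have n: "n = j + int r" using Suc.prems by simp
  have finP: "finite P" using Suc.prems finite_subset by blast
  define m where "m = nat (a + int (Suc r))"
  define F where "F b = card (avoiding_from n (j + 1) (insert j {x \<in> {..a} \<union> P. x \<le> j - b}))" for b
  \<comment> \<open>Since \<open>j - n = - int r\<close>, the usable nonpositive values are
    \<open>int k - int r\<close> with \<open>k < m\<close>.\<close>
  have B: "{b \<in> {1..n}. j - b \<in> {..a} \<union> P} = (\<lambda>p. j - p) ` P \<union> (\<lambda>k. j - (int k - int r)) ` {..<m}"
    (is "?B = ?P \<union> ?N")
  proof
    show "?B \<subseteq> ?P \<union> ?N"
    proof
      fix b assume b: "b \<in> ?B"
      show "b \<in> ?P \<union> ?N"
      proof (cases "j - b \<in> P")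
        case True
        thus ?thesis by (auto intro!: image_eqI[of _ _ "j - b"])
      next
        case False
        hence "b = j - (int (nat (j - b + int r)) - int r)" "nat (j - b + int r) < m"
          using b n by (auto simp: m_def)
        thus ?thesis by blast
      qed
    qed
    show "?P \<union> ?N \<subseteq> ?B"
      using Suc.prems n by (auto simp: m_def)
  qed
  have disj: "?P \<inter> ?N = {}"
  proof -
    have "0 < p" if "p \<in> P" for p using that Suc.prems by auto
    moreover have "int k - int r \<le> 0" if "k < m" for k using that Suc.prems by (simp add: m_def)
    ultimately show ?thesis by force
  qed
  have "card (avoiding_from n j ({..a} \<union> P)) = sum F ?B"
    using Suc.prems card_avoiding_from_step[of j n "{..a} \<union> P"] unfolding F_def by simp
  also have "\<dots> = sum F ?P + sum F ?N"
    unfolding B using finP disj by (intro sum.union_disjoint) auto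
  also have "sum F ?P = (\<Sum>p\<in>P. F (j - p))"
    by (subst sum.reindex) (auto simp: inj_on_def)
  also have "\<dots> = (\<Sum>p\<in>P. stack_walks r (m - 1) (Suc (card {x \<in> P. x \<le> p})))"
  proof (intro sum.cong refl)
    fix p assume p: "p \<in> P"
    let ?Q = "insert j {x \<in> P. x \<le> p}"
    have "insert j {x \<in> {..a} \<union> P. x \<le> j - (j - p)} = {..a} \<union> ?Q"
      using p Suc.prems by auto
    moreover have "card ?Q = Suc (card {x \<in> P. x \<le> p})"
      using finP Suc.prems by (subst card_insert_disjoint) auto
    moreover have "m - 1 = nat (a + int r)" by (simp add: m_def)
    moreover have "?Q \<subseteq> {1..<j + 1}"
      using Suc.prems by auto
    ultimately show "F (j - p) = stack_walks r (m - 1) (Suc (card {x \<in> P. x \<le> p}))"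
      unfolding F_def using Suc.IH[of a ?Q "j + 1"] Suc.prems by simp
  qed
  also have "\<dots> = (\<Sum>t<card P. stack_walks r (m - 1) (Suc (Suc t)))"
    by (rule sum_card_le[OF finP])
  also have "sum F ?N = (\<Sum>k<m. F (j - (int k - int r)))"
    by (subst sum.reindex) (auto simp: inj_on_def)
  also have "\<dots> = (\<Sum>k<m. stack_walks r k 1)"
  proof (intro sum.cong refl)
    fix k assume k: "k \<in> {..<m}"
    let ?a = "int k - int r"
    have le: "?a \<le> a" using k by (auto simp: m_def)
    \<comment> \<open>This choice discards all of \<open>P\<close> and lowers the ray to
      \<open>?a\<close>, leaving \<open>?a + int r = k\<close> usable values for the next
      step.\<close>
    have "insert j {x \<in> {..a} \<union> P. x \<le> j - (j - ?a)} = {..?a} \<union> {j}"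
      using Suc.prems le by auto
    hence "F (j - ?a) = card (avoiding_from n (j + 1) ({..?a} \<union> {j}))"
      unfolding F_def by (simp only:)
    also have "\<dots> = stack_walks r k 1"
      using Suc.IH[of ?a "{j}" "j + 1"] Suc.prems le by simp
    finally show "F (j - ?a) = stack_walks r k 1" .
  qed
  finally show ?case
    by (simp add: m_def)
qed

lemma card_avoiding_functions: "card (avoiding_functions n) = stack_walks n n 0"
proof -
  \<comment> \<open>Nothing is excluded before the first step: \<open>{..0}\<close> and
    \<open>{1..}\<close> together are all integers.\<close>
  have "avoiding_functions n = avoiding_from (int n) 1 ({..0} \<union> {})"
    by (auto simp: avoiding_functions_def avoiding_from_def)
  thus ?thesis
    using card_avoiding_from[of 0 "{}" 1 n "int n"] by simp
qed

theorem theorem1: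
  fixes n :: nat
  shows "catalan_transform catalan n = of_nat (card (avoiding_functions n))"
proof -
  have "catalan_transform catalan n = (\<Sum>k=0..n. of_nat (ballot k (n - k) * ballot 1 k))"
    unfolding catalan_transform_def
    by (intro sum.cong) (auto simp: catalan_coeff_eq_ballot catalan_eq_ballot)
  also have "\<dots> = of_nat (\<Sum>j\<le>n. ballot 1 (n - j) * ballot (n - j) j)"
    by (subst sum.atLeastAtMost_rev) (simp add: atMost_atLeast0 mult.commute)
  also have "(\<Sum>j\<le>n. ballot 1 (n - j) * ballot (n - j) j) = card (avoiding_functions n)"
    using stack_walks_diagonal[of n] unfolding card_avoiding_functions
    by (metis (no_types, lifting) of_nat_eq_iff of_nat_mult of_nat_sum sum.cong)
  finally show ?thesis .
qed

end
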